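(* Let $M$ be a connected matroid on a finite ground set $E$ and let $P(M)$ be its independence polytope. Then: (1) $\operatorname{rank}P(M)=0$ if and only if $M$ is the uniform matroid $U_{1,|E|}$. (2) $\operatorname{rank}P(M)\notin\{1,2\}$. (3) $\operatorname{rank}P(M)=3$ if and only if $M$ is (isomorphic to) the graphic matroid $M(\mathcal{D}_{s_1,s_2,s_3})$ for some $s_1,s_2,s_3\in\mathbb{Z}_{>0}$.
   Context: For a lattice polytope $P$ with $\dim P\ge 1$, $\operatorname{rank}P:=F-(\dim P+1)$, where $F$ is the number of facets of $P$. For a matroid $M$ on $E$, $P(M)=\mathrm{conv}\{\chi_I : I \text{ independent}\}\subset\mathbb{R}^E$, where $\chi_S$ is the indicator vector of $S$. $M$ is connected if every two elements of $E$ lie in a common circuit. $U_{r,n}$ is the uniform matroid of rank $r$ on $n$ elements. For a (not necessarily simple) graph $G$, $M(G)$ is the graphic matroid on $E(G)$ whose independent sets are the edge sets of forests. For $s_1,s_2,s_3\in\mathbb{Z}_{\ge0}$, $\mathcal{D}_{s_1,s_2,s_3}$ is the multigraph on vertices $v_1,v_2,v_3$ with $s_1$ parallel edges between $v_1,v_2$, $s_2$ parallel edges between $v_2,v_3$, and $s_3$ parallel edges between $v_3,v_1$. *)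

theory Defs
  imports "HOL-Analysis.Analysis"
begin

locale matroid =
  fixes E :: "'a set" and indep :: "'a set \<Rightarrow> bool"
  assumes finite_ground: "finite E"
    and indep_ground: "indep X \<Longrightarrow> X \<subseteq> E"
    and indep_empty: "indep {}"
    and indep_subset: "indep X \<Longrightarrow> Y \<subseteq> X \<Longrightarrow> indep Y"
    and indep_augment: "indep X \<Longrightarrow> indep Y \<Longrightarrow> card X < card Y \<Longrightarrow>
      \<exists>e\<in>Y - X. indep (insert e X)"

definition circuit :: "'a set \<Rightarrow> ('a set \<Rightarrow> bool) \<Rightarrow> 'a set \<Rightarrow> bool" where
  "circuit E indep C \<longleftrightarrow> C \<subseteq> E \<and> \<not> indep C \<and> (\<forall>D. D \<subset> C \<longrightarrow> indep D)"

text \<open>The two elements are distinct, so every matroid on a single element is connected;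
  with \<open>x = y\<close> allowed, the uniform matroid of rank 1 on one element would be excluded.\<close>

definition connected_matroid :: "'a set \<Rightarrow> ('a set \<Rightarrow> bool) \<Rightarrow> bool" where
  "connected_matroid E indep \<longleftrightarrow>
    (\<forall>x\<in>E. \<forall>y\<in>E. x \<noteq> y \<longrightarrow> (\<exists>C. circuit E indep C \<and> x \<in> C \<and> y \<in> C))"

definition matroid_iso ::
    "'a set \<Rightarrow> ('a set \<Rightarrow> bool) \<Rightarrow> 'b set \<Rightarrow> ('b set \<Rightarrow> bool) \<Rightarrow> bool" where
  "matroid_iso E indep E' indep' \<longleftrightarrow>
    (\<exists>f. bij_betw f E E' \<and> (\<forall>X. X \<subseteq> E \<longrightarrow> (indep X \<longleftrightarrow> indep' (f ` X))))"

text \<open>The condition \<open>r \<le> n\<close> makes \<open>r\<close> the actual rank: there is no uniform matroid of rank 1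
  on the empty set.\<close>

definition is_uniform_matroid :: "nat \<Rightarrow> nat \<Rightarrow> 'a set \<Rightarrow> ('a set \<Rightarrow> bool) \<Rightarrow> bool" where
  "is_uniform_matroid r n E indep \<longleftrightarrow>
    finite E \<and> card E = n \<and> r \<le> n \<and> (\<forall>X. indep X \<longleftrightarrow> X \<subseteq> E \<and> card X \<le> r)"

text \<open>A multigraph may have loops and parallel edges; \<open>ends e\<close> is the set of the one or two
  end vertices of the edge \<open>e\<close>.\<close>

record ('v, 'e) multigraph =
  verts :: "'v set"
  edges :: "'e set"
  ends :: "'e \<Rightarrow> 'v set"

text \<open>A cycle of length \<open>k\<close> runs through distinct vertices \<open>vs ! 0, \<dots>, vs ! (k - 1)\<close> and distinct
  edges. Length 1 is a loop, length 2 a pair of parallel edges.\<close>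

definition is_cycle :: "('v, 'e) multigraph \<Rightarrow> 'v list \<Rightarrow> 'e list \<Rightarrow> bool" where
  "is_cycle G vs es \<longleftrightarrow>
    vs \<noteq> [] \<and> length es = length vs \<and> distinct vs \<and> distinct es \<and>
    set vs \<subseteq> verts G \<and> set es \<subseteq> edges G \<and>
    (\<forall>i<length vs. ends G (es ! i) = {vs ! i, vs ! (Suc i mod length vs)})"

definition graphic_indep :: "('v, 'e) multigraph \<Rightarrow> 'e set \<Rightarrow> bool" where
  "graphic_indep G X \<longleftrightarrow>
    X \<subseteq> edges G \<and> \<not> (\<exists>vs es. is_cycle G vs es \<and> set es \<subseteq> X)"

text \<open>The edge \<open>(i, j)\<close> is the \<open>j\<close>-th of the parallel edges of the \<open>i\<close>-th class.\<close>

definition D_graph :: "nat \<Rightarrow> nat \<Rightarrow> nat \<Rightarrow> (nat, nat \<times> nat) multigraph" where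
  "D_graph s\<^sub>1 s\<^sub>2 s\<^sub>3 =
    \<lparr> verts = {1, 2, 3},
      edges = {1} \<times> {..<s\<^sub>1} \<union> {2} \<times> {..<s\<^sub>2} \<union> {3} \<times> {..<s\<^sub>3},
      ends = (\<lambda>(i, j). if i = 1 then {1, 2} else if i = 2 then {2, 3} else {3, 1}) \<rparr>"

definition chi :: "'a::finite set \<Rightarrow> real ^ 'a" where
  "chi S = (\<chi> e. if e \<in> S then 1 else 0)"

text \<open>The ground set \<open>E\<close> is a subset of a finite type \<open>'a\<close>, and \<open>\<real>\<^sup>E\<close> is the coordinate subspace
  of \<open>real ^ 'a\<close> of the vectors supported on \<open>E\<close> (all of it if \<open>E = UNIV\<close>). Dimension and
  facets of a polytope do not depend on the ambient space.\<close>

definition indep_polytope :: "('a::finite set \<Rightarrow> bool) \<Rightarrow> (real ^ 'a) set" where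
  "indep_polytope indep = convex hull {chi I | I. indep I}"

text \<open>Only meaningful for polytopes of dimension at least 1. A facet is nonempty by definition of
  \<open>facet_of\<close>, so the value for a single point is \<open>-1\<close>.\<close>

definition polytope_rank :: "'n::euclidean_space set \<Rightarrow> int" where
  "polytope_rank P = int (card {F. F facet_of P}) - (aff_dim P + 1)"

end

theory Submission
  imports Defs
begin

text \<open>Let \<open>M\<close> be connected of rank \<open>r \<ge> 1\<close> on \<open>n\<close> elements, with \<open>k\<close> parallel classes. Then \<open>M\<close> is
  loopless, so \<open>P(M)\<close> has dimension \<open>n\<close>, and the inequalities \<open>x\<^sub>e \<ge> 0\<close>, \<open>x(A) \<le> 1\<close> for a parallel
  class \<open>A\<close>, and \<open>x(E) \<le> r\<close> all define facets; connectedness is needed for the last one only. For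
  \<open>r \<ge> 2\<close> these are \<open>n + k + 1\<close> different facets, hence the rank of \<open>P(M)\<close> is at least \<open>k\<close>, and
  connectedness forces \<open>k > r\<close>. For \<open>r \<le> 2\<close> there are no other facets: the maximizers of a linear
  functional with nonnegative weights span its support, which is contained in a parallel class or
  has rank 2. So the rank of \<open>P(M)\<close> is 0 if \<open>r = 1\<close>, is \<open>k\<close> if \<open>r = 2\<close>, and is at least 4 if
  \<open>r \<ge> 3\<close>; if \<open>r = 0\<close>, then \<open>P(M)\<close> is a point and the value is -1. Finally \<open>r = 2\<close> and \<open>k = 3\<close> describes exactly the matroids of the graphs \<open>D\<close>.\<close>

section \<open>Bases and parallel classes\<close>

context matroid
begin

lemma finite_indep: "indep X \<Longrightarrow> finite X"
  using indep_ground finite_ground finite_subset by blast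

lemma finite_Collect_indep: "finite (Collect indep)"
  by (rule finite_subset[of _ "Pow E"]) (use indep_ground finite_ground in auto)

text \<open>Augmentation is repeated until the sizes agree. Keeping \<open>Z\<close> inside
  \<open>X \<union> Y\<close> is what the exchange arguments exploit.\<close>

lemma indep_extend:
  assumes "indep X" "indep Y" "card X \<le> card Y"
  obtains Z where "X \<subseteq> Z" "Z \<subseteq> X \<union> Y" "indep Z" "card Z = card Y"
proof -
  have "\<exists>Z. X \<subseteq> Z \<and> Z \<subseteq> X \<union> Y \<and> indep Z \<and> card Z = card Y"
    using assms
  proof (induction "card Y - card X" arbitrary: X)
    case 0
    then show ?case by (intro exI[of _ X]) auto
  next
    case (Suc n)
    then obtain e where e: "e \<in> Y - X" "indep (insert e X)"
      using indep_augment[of X Y] by (metis zero_less_Suc zero_less_diff)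
    have "card (insert e X) = Suc (card X)"
      using e finite_indep[OF Suc.prems(1)] by simp
    with Suc.hyps(2) have "n = card Y - card (insert e X)" "card (insert e X) \<le> card Y"
      by auto
    from Suc.hyps(1)[OF this(1) e(2) Suc.prems(2) this(2)]
    show ?case using e by blast
  qed
  then show thesis using that by blast
qed

definition mrank :: nat where
  "mrank = Max (card ` Collect indep)"

lemma card_le_mrank: "indep X \<Longrightarrow> card X \<le> mrank"
  unfolding mrank_def using finite_Collect_indep by auto

lemma basis_exists: obtains B where "indep B" "card B = mrank"
proof -
  have "mrank \<in> card ` Collect indep"
    unfolding mrank_def using finite_Collect_indep indep_empty by (intro Max_in) auto
  then show thesis using that by auto
qed

lemma indep_extend_basis:
  assumes "indep X" obtains B where "X \<subseteq> B" "indep B" "card B = mrank"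
  by (metis assms basis_exists card_le_mrank indep_extend)

lemma circuit_dependent: "circuit E indep C \<Longrightarrow> \<not> indep C"
  by (simp add: circuit_def)

lemma circuit_remove_indep: "circuit E indep C \<Longrightarrow> x \<in> C \<Longrightarrow> indep (C - {x})"
  by (auto simp: circuit_def)

lemma circuit_eq_dependent_subset:
  "circuit E indep C \<Longrightarrow> D \<subseteq> C \<Longrightarrow> \<not> indep D \<Longrightarrow> D = C"
  by (auto simp: circuit_def)

text \<open>\<open>B\<close> extends \<open>C - {x}\<close>, and extending \<open>C - {y}\<close> by
  elements of \<open>B\<close> gives a second basis. Neither contains all of \<open>C\<close>, so
  the second lies in \<open>insert x (B - {y})\<close>, and equal size makes them the same
  set.\<close>

lemma circuit_exchange:
  assumes C: "circuit E indep C" and x: "x \<in> C" and y: "y \<in> C" and "x \<noteq> y"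
  obtains B where "indep B" "card B = mrank" "x \<notin> B" "y \<in> B"
    "indep (insert x (B - {y}))" "card (insert x (B - {y})) = mrank"
proof -
  obtain B where B: "C - {x} \<subseteq> B" "indep B" "card B = mrank"
    using indep_extend_basis circuit_remove_indep[OF C x] by metis
  have yB: "y \<in> B" using B y \<open>x \<noteq> y\<close> by auto
  have "x \<notin> B"
    using B C x indep_subset[of B C] circuit_dependent by auto
  obtain B' where B': "C - {y} \<subseteq> B'" "B' \<subseteq> (C - {y}) \<union> B" "indep B'" "card B' = mrank"
    by (metis B(2,3) C card_le_mrank circuit_remove_indep indep_extend y)
  have "y \<notin> B'"
    using B' C y indep_subset[of B' C] circuit_dependent by auto
  with B B' have sub: "B' \<subseteq> insert x (B - {y})" by auto
  have card: "card (insert x (B - {y})) = mrank"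
    using B yB \<open>x \<notin> B\<close> finite_indep[of B]
    by (metis Diff_iff card.remove card_insert_disjoint finite_Diff)
  have "B' = insert x (B - {y})"
    using sub card B' finite_indep[of B]  B(2) by (intro card_subset_eq) auto
  with card B' that B yB \<open>x \<notin> B\<close> show thesis by simp
qed

text \<open>For a nonloop \<open>e\<close> the set \<open>{e, e}\<close> is independent, so the
  first disjunct is what puts \<open>e\<close> into its own class.\<close>

definition parallel_class :: "'a \<Rightarrow> 'a set" where
  "parallel_class e = {f \<in> E. f = e \<or> \<not> indep {e, f}}"

lemma parallel_class_subset: "parallel_class e \<subseteq> E"
  by (auto simp: parallel_class_def)

lemma self_in_parallel_class: "e \<in> E \<Longrightarrow> e \<in> parallel_class e"
  by (auto simp: parallel_class_def)

end

section \<open>Parallelism in loopless matroids\<close>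

locale loopless_matroid = matroid +
  assumes loopless: "e \<in> E \<Longrightarrow> indep {e}"
begin

text \<open>Transitivity: were \<open>{x, z}\<close> independent, augmenting \<open>{y}\<close> from
  it would make \<open>{x, y}\<close> or \<open>{y, z}\<close> independent.\<close>

lemma parallel_class_eq:
  assumes e: "e \<in> E" and f: "f \<in> parallel_class e"
  shows "parallel_class f = parallel_class e"
proof -
  have *: "\<not> indep {x, z}"
    if "x \<in> E" "y \<in> E" "z \<in> E" "x \<noteq> z" "\<not> indep {x, y}" "\<not> indep {y, z}" for x y z
    using indep_augment[of "{y}" "{x, z}"] loopless[of y] that by (auto simp: insert_commute)
  show ?thesis
    using e f *[of f e] *[of e f] unfolding parallel_class_def by (auto simp: insert_commute)
qed

lemma parallel_class_disjoint:
  assumes "A \<in> parallel_class ` E" "A' \<in> parallel_class ` E" "x \<in> A" "x \<in> A'"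
  shows "A = A'"
  using assms parallel_class_eq by blast

lemma card_indep_Int_parallel_class:
  assumes I: "indep I" and e: "e \<in> E"
  shows "card (I \<inter> parallel_class e) \<le> 1"
proof -
  have "x = y" if x: "x \<in> I \<inter> parallel_class e" and y: "y \<in> I \<inter> parallel_class e" for x y
  proof -
    have "y \<in> parallel_class x" using parallel_class_eq[OF e, of x] x y by auto
    moreover have "indep {x, y}" using x y indep_subset[OF I] by auto
    ultimately show "x = y" by (auto simp: parallel_class_def)
  qed
  then show ?thesis
    using finite_indep[OF I] card_le_Suc0_iff_eq[of "I \<inter> parallel_class e"] by auto
qed

lemma inj_on_parallel_class: "indep I \<Longrightarrow> inj_on parallel_class I"
proof (rule inj_onI)
  fix x y assume I: "indep I" and xy: "x \<in> I" "y \<in> I" "parallel_class x = parallel_class y"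
  have "x \<in> E" "y \<in> E" using I xy indep_ground by auto
  then have "y \<in> parallel_class x" using xy self_in_parallel_class by auto
  moreover have "indep {x, y}" using xy indep_subset[OF I] by auto
  ultimately show "x = y" by (auto simp: parallel_class_def)
qed

text \<open>Extending \<open>{b'}\<close> by elements of \<open>I\<close> to the size of
  \<open>I\<close> cannot pick up \<open>b\<close> if \<open>b\<close> differs from
  \<open>b'\<close>, so only the exchanged set is left.\<close>

lemma indep_exchange_parallel:
  assumes I: "indep I" and b: "b \<in> I" and b': "b' \<in> parallel_class b"
  shows "indep (insert b' (I - {b}))"
proof (cases "b' = b")
  case True
  then show ?thesis using I b by (simp add: insert_absorb)
next
  case False
  have "b' \<in> E" using b' by (auto simp: parallel_class_def)
  have "card {b'} \<le> card I" using I b finite_indep[OF I]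
    by (metis One_nat_def Suc_leI card_gt_0_iff empty_iff is_singletonI is_singleton_altdef)
  then obtain J where J: "{b'} \<subseteq> J" "J \<subseteq> {b'} \<union> I" "indep J" "card J = card I"
    using indep_extend[OF loopless[OF \<open>b' \<in> E\<close>] I] by metis
  have "b \<notin> J"
    using J(1,3) indep_subset[of J "{b, b'}"] b' False by (auto simp: parallel_class_def)
  then have "J \<subseteq> insert b' (I - {b})" using J by auto
  moreover have "card (insert b' (I - {b})) \<le> card J"
    using J(4) b finite_indep[OF I]
    by (metis card_insert_le_m1 card_gt_0_iff card_Diff_singleton empty_iff order_refl)
  ultimately have "J = insert b' (I - {b})"
    using finite_indep[OF I] by (intro card_seteq) auto
  then show ?thesis using J by simp
qed

lemma mrank_le_card_parallel_classes: "mrank \<le> card (parallel_class ` E)"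
proof -
  obtain B where B: "indep B" "card B = mrank" using basis_exists by blast
  have "card (parallel_class ` B) = mrank"
    using B inj_on_parallel_class card_image by metis
  then show ?thesis
    using card_mono[of "parallel_class ` E" "parallel_class ` B"] indep_ground[OF B(1)] finite_ground
    by (simp add: image_mono)
qed

text \<open>If there were only \<open>mrank\<close> classes, every basis would meet all of them. For a circuit \<open>C\<close>
  through \<open>x\<close>, exchanging an element parallel to \<open>x\<close> in a basis containing \<open>C - {x}\<close> would then
  make \<open>C\<close> independent.\<close>

lemma mrank_less_card_parallel_classes:
  assumes conn: "connected_matroid E indep" and r: "2 \<le> mrank"
  shows "mrank < card (parallel_class ` E)"
proof (rule ccontr)
  assume "\<not> ?thesis"
  then have k: "card (parallel_class ` E) = mrank" using mrank_le_card_parallel_classes by simp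
  obtain B where B: "indep B" "card B = mrank" using basis_exists by blast
  \<comment> \<open>Two elements of one basis are not parallel, so the circuit chosen through them
    below is not the pair \<open>{x, y}\<close>.\<close>
  obtain x y where xy: "x \<in> B" "y \<in> B" "x \<noteq> y"
    using B r card_le_Suc0_iff_eq[OF finite_indep[OF B(1)]] by fastforce
  have ixy: "indep {x, y}" using xy indep_subset[OF B(1)] by auto
  have xyE: "x \<in> E" "y \<in> E" using indep_ground[OF ixy] by auto
  then obtain C where C: "circuit E indep C" "x \<in> C" "y \<in> C"
    using conn \<open>x \<noteq> y\<close> unfolding connected_matroid_def by metis
  obtain B' where B': "C - {x} \<subseteq> B'" "indep B'" "card B' = mrank"
    using indep_extend_basis circuit_remove_indep[OF C(1,2)] by metis
  have "card (parallel_class ` B') = card (parallel_class ` E)"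
    using B' k inj_on_parallel_class card_image by metis
  then have "parallel_class ` B' = parallel_class ` E"
    using indep_ground[OF B'(2)] finite_ground by (intro card_subset_eq) auto
  then obtain b where b: "b \<in> B'" "parallel_class b = parallel_class x"
    using xyE by (metis imageE imageI)
  have xb: "x \<in> parallel_class b" using b xyE self_in_parallel_class by simp
  have "x \<notin> B'" using B' C indep_subset[of B' C] circuit_dependent by auto
  \<comment> \<open>Otherwise the dependent pair \<open>{b, x}\<close> is all of \<open>C\<close>,
    hence \<open>b = y\<close>, although \<open>{x, y}\<close> is independent.\<close>
  have "b \<notin> C"
  proof
    assume "b \<in> C"
    have "\<not> indep {b, x}" using xb b \<open>x \<notin> B'\<close> by (auto simp: parallel_class_def)
    then have "{b, x} = C"
      using circuit_eq_dependent_subset[OF C(1)] \<open>b \<in> C\<close> C by auto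
    then have "b = y" using C xy by auto
    then show False using \<open>\<not> indep {b, x}\<close> ixy by (simp add: insert_commute)
  qed
  then have "C \<subseteq> insert x (B' - {b})" using B' by auto
  then show False
    using indep_exchange_parallel[OF B'(2) b(1) xb] indep_subset circuit_dependent[OF C(1)] by blast
qed

end

text \<open>A circuit through a loop is that loop alone, whereas positive rank supplies a second
  element that must share a circuit with it.\<close>

lemma (in matroid) connected_loopless:
  assumes conn: "connected_matroid E indep" and r: "0 < mrank"
  shows "loopless_matroid E indep"
proof unfold_locales
  fix e assume e: "e \<in> E"
  show "indep {e}"
  proof (rule ccontr)
    assume ne: "\<not> indep {e}"
    obtain B where B: "indep B" "card B = mrank" using basis_exists by blast
    with r obtain b where b: "b \<in> B" by fastforce
    then have "b \<noteq> e" using ne indep_subset[OF B(1), of "{b}"] by auto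
    then obtain C where C: "circuit E indep C" "e \<in> C" "b \<in> C"
      using conn e b indep_ground[OF B(1)] unfolding connected_matroid_def by blast
    then have "{e} = C" using circuit_eq_dependent_subset[of C "{e}"] ne by auto
    with C \<open>b \<noteq> e\<close> show False by auto
  qed
qed

section \<open>Facets of the independence polytope\<close>

lemma inner_chi: "a \<bullet> chi I = (\<Sum>e\<in>I. a $ e)"
proof -
  have "a \<bullet> chi I = (\<Sum>e\<in>UNIV. if e \<in> I then a $ e else 0)"
    unfolding inner_vec_def chi_def by (intro sum.cong) auto
  then show ?thesis by (simp add: sum.If_cases)
qed

lemma inner_chi_chi: "chi S \<bullet> chi I = real (card (S \<inter> I))"
  unfolding inner_chi by (simp add: chi_def sum.If_cases Int_commute)

lemma chi_eq_sum: "chi I = (\<Sum>e\<in>I. chi {e})"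
proof -
  have "(\<Sum>e\<in>I. chi {e} $ i) = chi I $ i" for i
    by (simp add: chi_def)
  then show ?thesis by (simp add: vec_eq_iff)
qed

lemma chi_empty [simp]: "chi {} = 0"
  by (simp add: chi_def vec_eq_iff)

lemma chi_insert: "e \<notin> I \<Longrightarrow> chi (insert e I) = chi {e} + chi I"
  by (auto simp: chi_def vec_eq_iff)

lemma chi_in_indep_polytope: "indep I \<Longrightarrow> chi I \<in> indep_polytope indep"
  unfolding indep_polytope_def by (intro hull_inc) auto

lemma indep_polytope_halfspace:
  assumes "\<And>I. indep I \<Longrightarrow> a \<bullet> chi I \<le> b" "x \<in> indep_polytope indep"
  shows "a \<bullet> x \<le> b"
proof -
  have "indep_polytope indep \<subseteq> {x. a \<bullet> x \<le> b}"
    unfolding indep_polytope_def using assms(1)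
    by (intro hull_minimal convex_halfspace_le) auto
  with assms(2) show ?thesis by auto
qed

lemma polytope_indep_polytope: "polytope (indep_polytope indep)"
proof -
  have "finite {chi I | I. indep I}"
    by (rule finite_subset[of _ "range chi"]) auto
  then show ?thesis unfolding indep_polytope_def by (rule polytope_convex_hull)
qed

lemma convex_indep_polytope: "convex (indep_polytope indep)"
  unfolding indep_polytope_def by simp

lemma supporting_hyperplane_face:
  assumes "\<And>I. indep I \<Longrightarrow> a \<bullet> chi I \<le> b"
  shows "indep_polytope indep \<inter> {x. a \<bullet> x = b} face_of indep_polytope indep"
  by (intro face_of_Int_supporting_hyperplane_le convex_indep_polytope)
     (rule indep_polytope_halfspace[of indep a b, OF assms])

text \<open>A face of the hull of finitely many points is the hull of some of them, so an equation
  need only be tested at the points \<open>chi I\<close> in \<open>F\<close>.\<close>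

lemma face_subset_hyperplane:
  assumes F: "F face_of indep_polytope indep"
    and *: "\<And>I. indep I \<Longrightarrow> chi I \<in> F \<Longrightarrow> a \<bullet> chi I = b"
  shows "F \<subseteq> {x. a \<bullet> x = b}"
proof -
  have "finite {chi I | I. indep I}"
    by (rule finite_subset[of _ "range chi"]) auto
  from face_of_convex_hull_subset[OF finite_imp_compact[OF this] F[unfolded indep_polytope_def]]
  obtain V where V: "V \<subseteq> {chi I | I. indep I}" "F = convex hull V" .
  have "V \<subseteq> F" using V by (simp add: hull_subset)
  with V * have "V \<subseteq> {x. a \<bullet> x = b}" by auto
  then show ?thesis unfolding V by (intro hull_minimal convex_hyperplane)
qed

section \<open>Dimension of the polytope and criteria for facets\<close>

locale independence_polytope = loopless_matroid E indep
  for E :: "'a::finite set" and indep :: "'a set \<Rightarrow> bool" +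
  assumes mrank_pos: "0 < mrank"
begin

abbreviation P :: "(real ^ 'a) set" where
  "P \<equiv> indep_polytope indep"

lemma zero_in_P: "0 \<in> P"
  using chi_in_indep_polytope[of indep, OF indep_empty] by simp

lemma dim_chi_singletons: "S \<subseteq> E \<Longrightarrow> dim ((\<lambda>e. chi {e}) ` S) = card S"
proof -
  have axis: "chi {e} = axis e (1::real)" for e :: 'a
    by (auto simp: chi_def axis_def vec_eq_iff)
  have "(\<lambda>e. chi {e}) ` S \<subseteq> (Basis :: (real ^ 'a) set)"
    unfolding axis by (auto simp: Basis_vec_def)
  then have "independent ((\<lambda>e. chi {e} :: real ^ 'a) ` S)"
    using independent_Basis independent_mono by blast
  moreover have "inj_on (\<lambda>e. chi {e} :: real ^ 'a) S"
    unfolding axis by (auto simp: inj_on_def axis_eq_axis)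
  ultimately show ?thesis
    by (simp add: dim_eq_card_independent card_image)
qed

text \<open>The origin lies in \<open>P\<close>, so affine dimension is linear dimension;
  looplessness puts the unit vectors of \<open>E\<close> into \<open>P\<close>.\<close>

lemma aff_dim_P: "aff_dim P = int (card E)"
proof -
  have "P \<subseteq> span ((\<lambda>e. chi {e}) ` E)"
  proof -
    have "chi I \<in> span ((\<lambda>e. chi {e}) ` E)" if "indep I" for I
      unfolding chi_eq_sum[of I] using indep_ground[OF that]
      by (intro span_sum span_base) auto
    then show ?thesis unfolding indep_polytope_def
      by (intro hull_minimal) (auto intro: subspace_imp_convex)
  qed
  then have "dim P \<le> card E"
    using dim_subset dim_span dim_chi_singletons by (metis subset_refl)
  moreover have "card E \<le> dim P"
  proof -
    have "(\<lambda>e. chi {e}) ` E \<subseteq> P" using loopless chi_in_indep_polytope by blast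
    then show ?thesis using dim_subset dim_chi_singletons by (metis subset_refl)
  qed
  moreover have "0 \<in> affine hull P" using zero_in_P by (simp add: hull_inc)
  ultimately show ?thesis by (simp add: aff_dim_zero)
qed

text \<open>Adding the origin raises the affine dimension by at most one and yields at least
  \<open>card E\<close>; a proper face has less than \<open>card E\<close>. The criterion suits
  faces that avoid the origin.\<close>

lemma facet_ofI_span:
  assumes G: "G face_of P" "G \<noteq> P" "G \<noteq> {}"
    and sp: "\<And>e. e \<in> E \<Longrightarrow> chi {e} \<in> span G"
  shows "G facet_of P"
proof -
  have "aff_dim G < int (card E)"
    using face_of_aff_dim_lt[OF convex_indep_polytope G(1,2)] aff_dim_P by simp
  moreover have "card E \<le> dim (insert 0 G)"
  proof -
    have "(\<lambda>e. chi {e}) ` E \<subseteq> span G" using sp by auto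
    then show ?thesis using dim_subset[of _ "span G"] dim_chi_singletons[of E]
      by (metis span_insert_0 dim_span subset_refl)
  qed
  moreover have "aff_dim (insert 0 G) = int (dim (insert 0 G))"
    by (intro aff_dim_zero hull_inc) simp
  moreover have "aff_dim (insert 0 G) \<le> aff_dim G + 1"
    by (simp add: aff_dim_insert)
  ultimately show ?thesis using G aff_dim_P by (simp add: facet_of_def)
qed

text \<open>There is no dimension left between a facet and \<open>P\<close>. This identifies a facet
  from a mere inclusion in a known face.\<close>

lemma facet_eq_face:
  assumes F: "F facet_of P" and G: "G face_of P" "G \<noteq> P" and "F \<subseteq> G"
  shows "F = G"
proof (rule ccontr)
  assume "F \<noteq> G"
  have "F face_of G"
    using F G \<open>F \<subseteq> G\<close> facet_of_imp_face_of face_of_subset face_of_imp_subset by metis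
  then have "aff_dim F < aff_dim G"
    using face_of_aff_dim_lt face_of_imp_convex G \<open>F \<noteq> G\<close> by blast
  moreover have "aff_dim G < aff_dim P"
    using face_of_aff_dim_lt convex_indep_polytope G by blast
  ultimately show False using F by (simp add: facet_of_def)
qed

text \<open>All three kinds of faces use a functional \<open>chi S\<close>, so
  \<open>inner_chi_chi\<close> turns membership of \<open>chi I\<close> into counting.\<close>

definition coord_face :: "'a \<Rightarrow> (real ^ 'a) set" where
  "coord_face e = P \<inter> {x. chi {e} \<bullet> x = 0}"

definition class_face :: "'a set \<Rightarrow> (real ^ 'a) set" where
  "class_face A = P \<inter> {x. chi A \<bullet> x = 1}"

definition basis_face :: "(real ^ 'a) set" where
  "basis_face = P \<inter> {x. chi E \<bullet> x = real mrank}"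

lemma chi_in_coord_face: "indep I \<Longrightarrow> chi I \<in> coord_face e \<longleftrightarrow> e \<notin> I"
  by (simp add: coord_face_def chi_in_indep_polytope inner_chi_chi)

lemma chi_in_class_face: "indep I \<Longrightarrow> chi I \<in> class_face A \<longleftrightarrow> card (A \<inter> I) = 1"
  by (simp add: class_face_def chi_in_indep_polytope inner_chi_chi)

lemma chi_in_basis_face: "indep I \<Longrightarrow> chi I \<in> basis_face \<longleftrightarrow> card I = mrank"
  using indep_ground[of I]
  by (simp add: basis_face_def chi_in_indep_polytope inner_chi_chi Int_absorb1)

lemma zero_in_coord_face: "0 \<in> coord_face e"
  by (simp add: coord_face_def zero_in_P)

lemma zero_notin_class_face: "0 \<notin> class_face A"
  by (simp add: class_face_def)

lemma zero_notin_basis_face: "0 \<notin> basis_face"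
  using mrank_pos by (simp add: basis_face_def)

section \<open>The three families consist of facets\<close>

lemma coord_face_face: "e \<in> E \<Longrightarrow> coord_face e face_of P"
  \<comment> \<open>The sign turns nonnegativity of a coordinate into an upper bound.\<close>
  using supporting_hyperplane_face[of indep "- chi {e}" 0]
  by (simp add: coord_face_def inner_chi_chi)

lemma class_face_face:
  assumes "e \<in> E" shows "class_face (parallel_class e) face_of P"
  unfolding class_face_def
proof (rule supporting_hyperplane_face)
  show "chi (parallel_class e) \<bullet> chi I \<le> 1" if "indep I" for I
    using card_indep_Int_parallel_class[OF that assms] by (simp add: inner_chi_chi Int_commute)
qed

lemma basis_face_face: "basis_face face_of P"
  unfolding basis_face_def
proof (rule supporting_hyperplane_face)
  show "chi E \<bullet> chi I \<le> real mrank" if "indep I" for I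
    using indep_ground[OF that] card_le_mrank[OF that] by (simp add: inner_chi_chi Int_absorb1)
qed

lemma coord_face_neq_P: "e \<in> E \<Longrightarrow> coord_face e \<noteq> P"
  using chi_in_coord_face[of "{e}" e] chi_in_indep_polytope[of indep "{e}"] loopless by auto

lemma class_face_neq_P: "class_face A \<noteq> P"
  using zero_in_P zero_notin_class_face by blast

lemma basis_face_neq_P: "basis_face \<noteq> P"
  using zero_in_P zero_notin_basis_face by blast

text \<open>This face contains the origin, so its dimension is read off directly from the remaining
  unit vectors.\<close>

lemma coord_face_facet:
  assumes e: "e \<in> E" shows "coord_face e facet_of P"
proof -
  have "aff_dim (coord_face e) < int (card E)"
    using face_of_aff_dim_lt[OF convex_indep_polytope coord_face_face coord_face_neq_P] e aff_dim_P
    by simp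
  moreover have "card (E - {e}) \<le> dim (coord_face e)"
  proof -
    have "(\<lambda>e. chi {e}) ` (E - {e}) \<subseteq> coord_face e"
      using chi_in_coord_face loopless by auto
    then show ?thesis using dim_subset dim_chi_singletons by (metis Diff_subset)
  qed
  moreover have "aff_dim (coord_face e) = int (dim (coord_face e))"
    by (intro aff_dim_zero hull_inc zero_in_coord_face)
  ultimately have "aff_dim (coord_face e) = aff_dim P - 1"
    using e finite_ground aff_dim_P by simp
  then show ?thesis using coord_face_face[OF e] zero_in_coord_face[of e]
    by (auto simp: facet_of_def)
qed

text \<open>Unit vectors of the class lie on the face. For \<open>e\<close> outside,
  \<open>chi {e}\<close> is the difference of \<open>chi {a, e}\<close> and \<open>chi {a}\<close>,
  both on the face.\<close>

lemma class_face_facet: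
  assumes a: "a \<in> E" shows "class_face (parallel_class a) facet_of P"
proof (rule facet_ofI_span)
  let ?G = "class_face (parallel_class a)"
  have aG: "chi {a} \<in> ?G"
    using chi_in_class_face[OF loopless[OF a]] self_in_parallel_class[OF a] by simp
  then show "?G \<noteq> {}" by auto
  fix e assume e: "e \<in> E"
  show "chi {e} \<in> span ?G"
  proof (cases "e \<in> parallel_class a")
    case True
    then show ?thesis using chi_in_class_face[OF loopless[OF e]] by (simp add: span_base)
  next
    case False
    then have "e \<noteq> a" "indep {a, e}" using e self_in_parallel_class[OF a]
      by (auto simp: parallel_class_def)
    moreover have "parallel_class a \<inter> {a, e} = {a}"
      using False self_in_parallel_class[OF a] by auto
    ultimately have "chi {a, e} \<in> ?G" by (simp add: chi_in_class_face)
    moreover have "chi {e} = chi {a, e} - chi {a}"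
      using \<open>e \<noteq> a\<close> by (simp add: chi_insert[of a "{e}"])
    ultimately show ?thesis using aG by (simp add: span_base span_diff)
  qed
qed (use a class_face_face class_face_neq_P in auto)

text \<open>Basis exchange along circuits gives \<open>chi {e} - chi {f}\<close> in the span for all \<open>e\<close> and \<open>f\<close>.\<close>

lemma basis_face_facet:
  assumes conn: "connected_matroid E indep" shows "basis_face facet_of P"
proof (rule facet_ofI_span)
  obtain B where B: "indep B" "card B = mrank" using basis_exists by blast
  then have BG: "chi B \<in> basis_face" by (simp add: chi_in_basis_face)
  then show "basis_face \<noteq> {}" by auto
  have diff: "chi {e} - chi {f} \<in> span basis_face" if ef: "e \<in> E" "f \<in> E" for e f
  proof (cases "e = f")
    case True
    then show ?thesis by (simp add: span_zero)
  next
    case False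
    then obtain C where C: "circuit E indep C" "e \<in> C" "f \<in> C"
      using conn ef unfolding connected_matroid_def by blast
    obtain B where B: "indep B" "card B = mrank" "e \<notin> B" "f \<in> B"
      "indep (insert e (B - {f}))" "card (insert e (B - {f})) = mrank"
      using circuit_exchange[OF C False] by blast
    have "chi B = chi {f} + chi (B - {f})" "chi (insert e (B - {f})) = chi {e} + chi (B - {f})"
      using B chi_insert[of f "B - {f}"] chi_insert[of e "B - {f}"] by (auto simp: insert_absorb)
    then have "chi {e} - chi {f} = chi (insert e (B - {f})) - chi B" by simp
    then show ?thesis using B by (simp add: chi_in_basis_face span_base span_diff)
  qed
  fix e assume e: "e \<in> E"
  \<comment> \<open>Each difference replaces one summand \<open>chi {f}\<close> of
    \<open>chi B\<close> by \<open>chi {e}\<close>.\<close>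
  have "real mrank *\<^sub>R chi {e} = chi B + (\<Sum>f\<in>B. chi {e} - chi {f})"
    unfolding chi_eq_sum[of B] sum_subtractf using B
    by (simp add: sum_constant_scaleR del: sum_constant)
  also have "\<dots> \<in> span basis_face"
    using BG indep_ground[OF B(1)] diff[OF e] by (intro span_add span_sum) (auto intro: span_base)
  finally have "(1 / real mrank) *\<^sub>R (real mrank *\<^sub>R chi {e}) \<in> span basis_face"
    by (rule span_scale)
  then show "chi {e} \<in> span basis_face" using mrank_pos by simp
qed (use basis_face_face basis_face_neq_P in auto)

text \<open>Otherwise an element of \<open>J\<close> could be added to \<open>I \<inter> {e. a $ e > 0}\<close>, the part of \<open>I\<close>
  that carries its weight.\<close>

lemma maximizer_spans_support:
  assumes nn: "\<And>e. e \<in> E \<Longrightarrow> 0 \<le> a $ e" and I: "indep I"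
    and mx: "\<And>K. indep K \<Longrightarrow> a \<bullet> chi K \<le> a \<bullet> chi I"
    and J: "indep J" "J \<subseteq> {e \<in> E. 0 < a $ e}"
  shows "card J \<le> card ({e \<in> E. 0 < a $ e} \<inter> I)"
proof (rule ccontr)
  let ?I = "{e \<in> E. 0 < a $ e} \<inter> I"
  assume "\<not> ?thesis"
  moreover have iI: "indep ?I" using indep_subset[OF I] by simp
  ultimately obtain e where e: "e \<in> J - ?I" "indep (insert e ?I)"
    using indep_augment[OF iI J(1)] by auto
  \<comment> \<open>Elements of \<open>I\<close> outside the support have weight 0, as weights on
    \<open>E\<close> are nonnegative.\<close>
  have "a \<bullet> chi I = a \<bullet> chi ?I"
    unfolding inner_chi using indep_ground[OF I] nn
    by (intro sum.mono_neutral_right) (force simp: finite_indep[OF I])+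
  moreover have "a \<bullet> chi (insert e ?I) = a $ e + a \<bullet> chi ?I"
    unfolding inner_chi using e by (subst sum.insert) auto
  ultimately show False using mx[OF e(2)] e J by auto
qed

text \<open>The signs on \<open>E\<close> of a functional exposing \<open>F\<close> decide. A
  negative weight at \<open>e\<close> keeps \<open>e\<close> out of every maximizer, and zero
  weights would expose all of \<open>P\<close>. Otherwise maximizers span the support: if it
  contains an independent pair, they are bases because \<open>mrank \<le> 2\<close>; if not, it lies
  in one parallel class, which they all meet.\<close>

lemma facet_cases:
  assumes F: "F facet_of P" and r: "mrank \<le> 2"
  shows "F \<in> coord_face ` E \<union> class_face ` parallel_class ` E \<union> {basis_face}"
proof -
  have Fface: "F face_of P" using F facet_of_imp_face_of by blast
  have "F exposed_face_of P"
    using exposed_face_of_polyhedron[OF polytope_imp_polyhedron[OF polytope_indep_polytope]] Fface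
    by blast
  then obtain a b where ab: "P \<subseteq> {x. a \<bullet> x \<le> b}" "F = P \<inter> {x. a \<bullet> x = b}"
    unfolding exposed_face_of_def by blast
  have le: "a \<bullet> chi I \<le> b" if "indep I" for I
    using ab chi_in_indep_polytope[of indep I] that by auto
  have FnP: "F \<noteq> P" "F \<noteq> {}" using F by (auto simp: facet_of_def)
  let ?S = "{e \<in> E. 0 < a $ e}"
  consider (neg) e where "e \<in> E" "a $ e < 0"
    | (zero) "\<And>e. e \<in> E \<Longrightarrow> 0 \<le> a $ e" "?S = {}"
    | (pos) s where "\<And>e. e \<in> E \<Longrightarrow> 0 \<le> a $ e" "s \<in> ?S"
    by (metis equals0I linorder_not_le)
  then show ?thesis
  proof cases
    case neg
    have "F \<subseteq> {x. chi {e} \<bullet> x = 0}"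
    proof (rule face_subset_hyperplane[OF Fface])
      fix I assume I: "indep I" "chi I \<in> F"
      have "e \<notin> I"
      proof
        assume eI: "e \<in> I"
        \<comment> \<open>Dropping \<open>e\<close> would raise the value above the maximum
          \<open>b\<close>.\<close>
        have "a \<bullet> chi I = a $ e + a \<bullet> chi (I - {e})"
          unfolding inner_chi using eI finite_indep[OF I(1)] by (simp add: sum.remove)
        moreover have "a \<bullet> chi (I - {e}) \<le> b" using le indep_subset[OF I(1)] by simp
        ultimately show False using I ab neg by simp
      qed
      then show "chi {e} \<bullet> chi I = 0" by (simp add: inner_chi_chi)
    qed
    then have "F \<subseteq> coord_face e" using ab by (auto simp: coord_face_def)
    then have "F = coord_face e"
      using facet_eq_face[OF F coord_face_face coord_face_neq_P] neg by auto
    with neg show ?thesis by auto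
  next
    case zero
    have "a \<bullet> chi I = 0" if "indep I" for I
      unfolding inner_chi using zero indep_ground[OF that] by (intro sum.neutral) force
    \<comment> \<open>\<open>P\<close> counts as a face of itself here.\<close>
    then have "P \<subseteq> {x. a \<bullet> x = 0}"
      using face_subset_hyperplane[of P indep a 0] convex_indep_polytope face_of_refl by blast
    moreover obtain x where "x \<in> F" using FnP by auto
    ultimately have "b = 0" using ab by auto
    with ab(2) \<open>P \<subseteq> {x. a \<bullet> x = 0}\<close> have "F = P" by auto
    with FnP show ?thesis by simp
  next
    case pos
    have meet: "card J \<le> card (?S \<inter> I)" if "indep I" "chi I \<in> F" "indep J" "J \<subseteq> ?S" for I J
      by (rule maximizer_spans_support[OF pos(1) that(1) _ that(3,4)])
         (use le ab(2) that(2) in auto)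
    show ?thesis
    proof (cases "\<exists>t\<in>?S. t \<noteq> s \<and> indep {s, t}")
      case True
      then obtain t where t: "t \<in> ?S" "t \<noteq> s" "indep {s, t}" by auto
      have "F \<subseteq> {x. chi E \<bullet> x = real mrank}"
      proof (rule face_subset_hyperplane[OF Fface])
        fix I assume I: "indep I" "chi I \<in> F"
        have "2 \<le> card (?S \<inter> I)" using meet[OF I t(3)] t pos by auto
        also have "\<dots> \<le> card I" by (intro card_mono finite_indep[OF I(1)]) auto
        finally have "card I = mrank" using card_le_mrank[OF I(1)] r by simp
        then show "chi E \<bullet> chi I = real mrank"
          using indep_ground[OF I(1)] by (simp add: inner_chi_chi Int_absorb1)
      qed
      then have "F \<subseteq> basis_face" using ab by (auto simp: basis_face_def)
      then show ?thesis using facet_eq_face[OF F basis_face_face basis_face_neq_P] by auto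
    next
      case False
      then have S: "?S \<subseteq> parallel_class s" by (auto simp: parallel_class_def)
      have sE: "s \<in> E" using pos by auto
      have "F \<subseteq> {x. chi (parallel_class s) \<bullet> x = 1}"
      proof (rule face_subset_hyperplane[OF Fface])
        fix I assume I: "indep I" "chi I \<in> F"
        have "1 \<le> card (?S \<inter> I)" using meet[OF I loopless[OF sE]] pos by auto
        also have "\<dots> \<le> card (I \<inter> parallel_class s)"
          using S by (intro card_mono) (auto simp: finite_indep[OF I(1)])
        finally have "card (I \<inter> parallel_class s) = 1"
          using card_indep_Int_parallel_class[OF I(1) sE] by simp
        then show "chi (parallel_class s) \<bullet> chi I = 1"
          by (simp add: inner_chi_chi Int_commute)
      qed
      then have "F \<subseteq> class_face (parallel_class s)" using ab by (auto simp: class_face_def)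
      then show ?thesis
        using facet_eq_face[OF F class_face_face class_face_neq_P] sE by auto
    qed
  qed
qed

section \<open>Counting the facets\<close>

lemma inj_on_coord_face: "inj_on coord_face E"
proof (rule inj_onI)
  fix e f assume e: "e \<in> E" and eq: "coord_face e = coord_face f"
  have "chi {e} \<notin> coord_face f"
    unfolding eq[symmetric] using chi_in_coord_face[OF loopless[OF e]] by simp
  then show "e = f" using chi_in_coord_face[OF loopless[OF e]] by simp
qed

text \<open>For \<open>a\<close> in \<open>A\<close>, the point \<open>chi {a}\<close> lies on the
  face of \<open>A'\<close> only if \<open>a\<close> is in \<open>A'\<close>, and distinct classes
  are disjoint.\<close>

lemma inj_on_class_face: "inj_on class_face (parallel_class ` E)"
proof (rule inj_onI)
  fix A A' assume A: "A \<in> parallel_class ` E" "A' \<in> parallel_class ` E"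
    and eq: "class_face A = class_face A'"
  obtain a where a: "a \<in> E" "A = parallel_class a" using A by auto
  have aA: "a \<in> A" using a self_in_parallel_class by simp
  then have "chi {a} \<in> class_face A" using chi_in_class_face loopless a(1) by simp
  then have "a \<in> A'" using eq chi_in_class_face[OF loopless[OF a(1)], of A']
    by (cases "a \<in> A'") auto
  with aA A show "A = A'" using parallel_class_disjoint by blast
qed

lemma finite_facets: "finite {F. F facet_of P}"
  using finite_polytope_facets[OF polytope_indep_polytope] .

lemma card_coord_basis_faces: "card (coord_face ` E \<union> {basis_face}) = card E + 1"
proof -
  have "basis_face \<notin> coord_face ` E" using zero_in_coord_face zero_notin_basis_face by blast
  with finite_ground have "card (insert basis_face (coord_face ` E)) = Suc (card (coord_face ` E))"
    by (intro card_insert_disjoint finite_imageI)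
  then show ?thesis
    by (simp only: card_image[OF inj_on_coord_face] Un_insert_right Un_empty_right Suc_eq_plus1)
qed

text \<open>The origin separates the coordinate faces from the others. Rank at least 2 separates
  \<open>basis_face\<close> from the class faces, since singletons are not bases.\<close>

lemma card_all_faces:
  assumes "2 \<le> mrank"
  shows "card (coord_face ` E \<union> class_face ` parallel_class ` E \<union> {basis_face}) =
    card E + card (parallel_class ` E) + 1"
proof -
  have "basis_face \<noteq> class_face (parallel_class e)" if "e \<in> E" for e
  proof -
    have "chi {e} \<in> class_face (parallel_class e)"
      using chi_in_class_face loopless self_in_parallel_class that by simp
    moreover have "chi {e} \<notin> basis_face"
      using chi_in_basis_face[OF loopless[OF that]] assms by simp
    ultimately show ?thesis by blast
  qed
  then have "class_face ` parallel_class ` E \<inter> (coord_face ` E \<union> {basis_face}) = {}"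
    using zero_in_coord_face zero_notin_class_face by blast
  from card_Un_disjoint[OF _ _ this] finite_ground
  have "card (class_face ` parallel_class ` E \<union> (coord_face ` E \<union> {basis_face})) =
      card (parallel_class ` E) + (card E + 1)"
    unfolding card_coord_basis_faces card_image[OF inj_on_class_face] by blast
  then show ?thesis by (simp only: Un_ac add_ac)
qed

lemma faces_are_facets:
  assumes "connected_matroid E indep"
  shows "coord_face ` E \<union> class_face ` parallel_class ` E \<union> {basis_face} \<subseteq> {F. F facet_of P}"
proof -
  have "coord_face ` E \<subseteq> {F. F facet_of P}"
    by (intro image_subsetI CollectI coord_face_facet)
  moreover have "class_face ` parallel_class ` E \<subseteq> {F. F facet_of P}"
    unfolding image_image by (intro image_subsetI CollectI class_face_facet)
  ultimately show ?thesis
    using basis_face_facet[OF assms] by (intro Un_least) simp_all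
qed

lemma polytope_rank_ge:
  assumes "connected_matroid E indep" "2 \<le> mrank"
  shows "int (card (parallel_class ` E)) \<le> polytope_rank P"
  using card_mono[OF finite_facets faces_are_facets[OF assms(1)]]
  unfolding card_all_faces[OF assms(2)] polytope_rank_def aff_dim_P by linarith

lemma polytope_rank_mrank_2:
  assumes "connected_matroid E indep" "mrank = 2"
  shows "polytope_rank P = int (card (parallel_class ` E))"
proof -
  have "{F. F facet_of P} \<subseteq> coord_face ` E \<union> class_face ` parallel_class ` E \<union> {basis_face}"
    using facet_cases assms(2) by fastforce
  with faces_are_facets[OF assms(1)]
  have *: "{F. F facet_of P} = coord_face ` E \<union> class_face ` parallel_class ` E \<union> {basis_face}"
    by (rule equalityI[rotated])
  have "2 \<le> mrank" using assms(2) by simp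
  then show ?thesis
    unfolding polytope_rank_def aff_dim_P * card_all_faces[OF \<open>2 \<le> mrank\<close>] by linarith
qed

text \<open>Any two elements are parallel, so the only class is \<open>E\<close> and its face
  coincides with \<open>basis_face\<close>; \<open>card E + 1\<close> facets remain.\<close>

lemma polytope_rank_mrank_1:
  assumes "connected_matroid E indep" "mrank = 1"
  shows "polytope_rank P = 0"
proof -
  have "\<not> indep {e, f}" if "e \<noteq> f" for e f
    using card_le_mrank[of "{e, f}"] that assms(2) by auto
  then have "parallel_class e = E" if "e \<in> E" for e
    by (auto simp: parallel_class_def)
  then have cls: "class_face ` parallel_class ` E \<subseteq> {basis_face}"
    by (auto simp: class_face_def basis_face_def assms(2))
  have "{F. F facet_of P} \<subseteq> coord_face ` E \<union> class_face ` parallel_class ` E \<union> {basis_face}"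
    using facet_cases assms(2) by fastforce
  also have "\<dots> \<subseteq> coord_face ` E \<union> {basis_face}"
    using cls by blast
  finally have *: "{F. F facet_of P} = coord_face ` E \<union> {basis_face}"
    using faces_are_facets[OF assms(1)] by (intro equalityI) simp_all
  show ?thesis
    unfolding polytope_rank_def aff_dim_P * card_coord_basis_faces by simp
qed

end

section \<open>The matroids of the graphs D\<close>

lemma D_graph_fst: "e \<in> edges (D_graph s\<^sub>1 s\<^sub>2 s\<^sub>3) \<Longrightarrow> fst e \<in> {1, 2, 3}"
  by (auto simp: D_graph_def)

lemma D_graph_ends:
  "ends (D_graph s\<^sub>1 s\<^sub>2 s\<^sub>3) e = (if fst e = 1 then {1, 2} else if fst e = 2 then {2, 3} else {3, 1})"
  by (cases e) (simp add: D_graph_def)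

lemma D_graph_ends_cases:
  assumes "e \<in> edges (D_graph s\<^sub>1 s\<^sub>2 s\<^sub>3)"
  obtains u v where "u \<noteq> v" "u \<in> {1, 2, 3}" "v \<in> {1, 2, 3}" "ends (D_graph s\<^sub>1 s\<^sub>2 s\<^sub>3) e = {u, v}"
proof -
  from D_graph_fst[OF assms] consider "fst e = 1" | "fst e = 2" | "fst e = 3" by blast
  then show thesis
  proof cases
    case 1
    with that[of 1 2] show ?thesis by (simp add: D_graph_ends)
  next
    case 2
    with that[of 2 3] show ?thesis by (simp add: D_graph_ends)
  next
    case 3
    with that[of 3 1] show ?thesis by (simp add: D_graph_ends)
  qed
qed

text \<open>The first component of an edge names its class. The only cycles are two edges of one
  class and triangles with one edge from each class.\<close>

lemma graphic_indep_D_graph: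
  "graphic_indep (D_graph s\<^sub>1 s\<^sub>2 s\<^sub>3) X \<longleftrightarrow>
    X \<subseteq> edges (D_graph s\<^sub>1 s\<^sub>2 s\<^sub>3) \<and> inj_on fst X \<and> card X \<le> 2"
  (is "graphic_indep ?G X \<longleftrightarrow> _")
proof (intro iffI conjI)
  assume X: "graphic_indep ?G X"
  then show sub: "X \<subseteq> edges ?G" by (simp add: graphic_indep_def)
  have acyclic: False if "is_cycle ?G vs es" "set es \<subseteq> X" for vs es
    using X that by (auto simp: graphic_indep_def)
  have verts: "verts ?G = {1, 2, 3}" by (simp add: D_graph_def)
  show inj: "inj_on fst X"
  proof (rule inj_onI, rule ccontr)
    fix x y assume xy: "x \<in> X" "y \<in> X" "fst x = fst y" "x \<noteq> y"
    obtain u v where uv: "u \<noteq> v" "u \<in> {1, 2, 3}" "v \<in> {1, 2, 3}" "ends ?G x = {u, v}"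
      by (rule D_graph_ends_cases[OF subsetD[OF sub xy(1)]])
    have "ends ?G y = ends ?G x" using xy(3) by (simp only: D_graph_ends)
    \<comment> \<open>The second edge of a cycle of length 2 runs back from \<open>v\<close> to
      \<open>u\<close>.\<close>
    then have "ends ?G y = {v, u}" using uv(4) by (simp add: insert_commute)
    then have "is_cycle ?G [u, v] [x, y]"
      using xy sub uv unfolding is_cycle_def verts
      by (auto simp: less_Suc_eq)
    from acyclic[OF this] xy show False by simp
  qed
  show "card X \<le> 2"
  proof (rule ccontr)
    assume "\<not> card X \<le> 2"
    then have "3 \<le> card (fst ` X)" using inj by (simp add: card_image)
    moreover have "fst ` X \<subseteq> {1, 2, 3}" using sub D_graph_fst by blast
    ultimately have "fst ` X = {1, 2, 3}" by (intro card_seteq) auto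
    then have "1 \<in> fst ` X" "2 \<in> fst ` X" "3 \<in> fst ` X" by simp_all
    then obtain x y z where "x \<in> X" "y \<in> X" "z \<in> X" "fst x = 1" "fst y = 2" "fst z = 3"
      by (elim imageE) simp
    moreover from this have "is_cycle ?G [1, 2, 3] [x, y, z]"
      using sub unfolding is_cycle_def verts
      by (auto simp: less_Suc_eq D_graph_ends)
    ultimately show False using acyclic[of "[1, 2, 3]" "[x, y, z]"] by simp
  qed
next
  assume X: "X \<subseteq> edges ?G \<and> inj_on fst X \<and> card X \<le> 2"
  have "finite (edges ?G)" by (simp add: D_graph_def)
  then have fin: "finite X" using X finite_subset by blast
  show "graphic_indep ?G X"
    unfolding graphic_indep_def
  proof (intro conjI notI)
    assume "\<exists>vs es. is_cycle ?G vs es \<and> set es \<subseteq> X"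
    then obtain vs es where c: "is_cycle ?G vs es" "set es \<subseteq> X" by blast
    \<comment> \<open>Distinct edges bound the length by \<open>card X\<close>, so only loops and
      parallel pairs remain to be excluded.\<close>
    have "length vs = card (set es)"
      using c(1) by (simp add: is_cycle_def distinct_card)
    also have "\<dots> \<le> 2" using card_mono[OF fin c(2)] X by simp
    finally consider "length vs = 1" | "length vs = 2"
      using c(1) by (fastforce simp: is_cycle_def le_Suc_eq numeral_2_eq_2)
    then show False
    proof cases
      case 1
      then have "ends ?G (es ! 0) = {vs ! 0}" using c(1) by (auto simp: is_cycle_def)
      then show False
        by (auto simp: D_graph_ends doubleton_eq_iff[of _ _ "vs ! 0" "vs ! 0", simplified]
            split: if_splits)
    next
      case 2
      then have "ends ?G (es ! 0) = ends ?G (es ! 1)" "es ! 0 \<noteq> es ! 1"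
          "es ! 0 \<in> set es" "es ! 1 \<in> set es"
        using c(1) by (auto simp: is_cycle_def nth_eq_iff_index_eq insert_commute)
      moreover from this have "fst (es ! 0) = fst (es ! 1)"
        using D_graph_fst[of "es ! 0"] D_graph_fst[of "es ! 1"] c(2) X
        by (fastforce simp: D_graph_ends doubleton_eq_iff split: if_splits)
      ultimately show False using X c(2) by (meson inj_onD subsetD)
    qed
  qed (use X in simp)
qed

lemma D_graph_fst_image:
  assumes "0 < s\<^sub>1" "0 < s\<^sub>2" "0 < s\<^sub>3"
  shows "fst ` edges (D_graph s\<^sub>1 s\<^sub>2 s\<^sub>3) = {1, 2, 3}"
  using assms by (auto simp: D_graph_def image_Un fst_image_times lessThan_empty_iff)

lemma iso_D_graph_indep_pair:
  assumes f: "bij_betw f E (edges (D_graph s\<^sub>1 s\<^sub>2 s\<^sub>3))"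
    and iso: "\<forall>X. X \<subseteq> E \<longrightarrow> (indep X \<longleftrightarrow> graphic_indep (D_graph s\<^sub>1 s\<^sub>2 s\<^sub>3) (f ` X))"
    and xy: "x \<in> E" "y \<in> E" "x \<noteq> y"
  shows "indep {x, y} \<longleftrightarrow> fst (f x) \<noteq> fst (f y)"
proof -
  have "f x \<noteq> f y" "f x \<in> edges (D_graph s\<^sub>1 s\<^sub>2 s\<^sub>3)" "f y \<in> edges (D_graph s\<^sub>1 s\<^sub>2 s\<^sub>3)"
    using f xy by (auto simp: bij_betw_def inj_on_def)
  moreover have "indep {x, y} \<longleftrightarrow> graphic_indep (D_graph s\<^sub>1 s\<^sub>2 s\<^sub>3) (f ` {x, y})"
    using iso[rule_format, of "{x, y}"] xy by simp
  ultimately show ?thesis by (auto simp: graphic_indep_D_graph)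
qed

text \<open>Positivity provides edges of two different classes, which pull back to an independent
  pair. Looplessness is not assumed, so ranks 0 and 1 can be excluded by it.\<close>

lemma (in matroid) iso_D_graph_mrank:
  assumes iso: "matroid_iso E indep (edges (D_graph s\<^sub>1 s\<^sub>2 s\<^sub>3)) (graphic_indep (D_graph s\<^sub>1 s\<^sub>2 s\<^sub>3))"
    and s: "0 < s\<^sub>1" "0 < s\<^sub>2" "0 < s\<^sub>3"
  shows "2 \<le> mrank"
proof -
  let ?G = "D_graph s\<^sub>1 s\<^sub>2 s\<^sub>3"
  obtain f where f: "bij_betw f E (edges ?G)"
    and i: "\<forall>X. X \<subseteq> E \<longrightarrow> (indep X \<longleftrightarrow> graphic_indep ?G (f ` X))"
    using iso unfolding matroid_iso_def by (elim exE conjE)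
  have "(1, 0) \<in> f ` E" "(2, 0) \<in> f ` E"
    using f s by (auto simp: bij_betw_def D_graph_def)
  then obtain x y where xy: "x \<in> E" "y \<in> E" "f x = (1, 0)" "f y = (2, 0)"
    by (elim imageE) simp
  then have "x \<noteq> y" by auto
  then have "indep {x, y}" using iso_D_graph_indep_pair[OF f i] xy by simp
  from card_le_mrank[OF this] show ?thesis using \<open>x \<noteq> y\<close> by simp
qed

text \<open>Both images index the same partition of \<open>E\<close>, once by blocks and once by
  labels.\<close>

lemma card_image_same_fibres:
  assumes "\<And>x. x \<in> E \<Longrightarrow> p x = {y \<in> E. g y = g x}"
  shows "card (p ` E) = card (g ` E)"
proof -
  let ?h = "\<lambda>c. {y \<in> E. g y = c}"
  have "p ` E = ?h ` g ` E" using assms by (auto simp: image_image)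
  moreover have "inj_on ?h (g ` E)" by (auto simp: inj_on_def)
  ultimately show ?thesis by (simp add: card_image)
qed

lemma bij_betw_tag:
  assumes "bij_betw h A S" "\<And>x. x \<in> A \<Longrightarrow> f x = (c, h x)"
  shows "bij_betw f A ({c} \<times> S)"
  unfolding bij_betw_def
proof
  show "inj_on f A" using assms by (auto simp: bij_betw_def inj_on_def)
  have "f ` A = Pair c ` h ` A" using assms(2) by (simp add: image_image cong: image_cong_simp)
  also have "\<dots> = {c} \<times> S" using bij_betw_imp_surj_on[OF assms(1)] by auto
  finally show "f ` A = {c} \<times> S" .
qed

section \<open>Rank 2 with three parallel classes, and rank 1\<close>

context loopless_matroid
begin

lemma iso_D_graph_card_parallel_classes:
  assumes iso: "matroid_iso E indep (edges (D_graph s\<^sub>1 s\<^sub>2 s\<^sub>3)) (graphic_indep (D_graph s\<^sub>1 s\<^sub>2 s\<^sub>3))"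
    and s: "0 < s\<^sub>1" "0 < s\<^sub>2" "0 < s\<^sub>3"
  shows "card (parallel_class ` E) = 3"
proof -
  let ?G = "D_graph s\<^sub>1 s\<^sub>2 s\<^sub>3"
  obtain f where f: "bij_betw f E (edges ?G)"
    and i: "\<forall>X. X \<subseteq> E \<longrightarrow> (indep X \<longleftrightarrow> graphic_indep ?G (f ` X))"
    using iso unfolding matroid_iso_def by (elim exE conjE)
  have "y = x \<or> \<not> indep {x, y} \<longleftrightarrow> fst (f y) = fst (f x)" if "x \<in> E" "y \<in> E" for x y
    using iso_D_graph_indep_pair[OF f i that] by (cases "y = x") auto
  then have "parallel_class x = {y \<in> E. fst (f y) = fst (f x)}" if "x \<in> E" for x
    using that by (auto simp: parallel_class_def)
  then have "card (parallel_class ` E) = card ((\<lambda>x. fst (f x)) ` E)"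
    by (rule card_image_same_fibres)
  also have "(\<lambda>x. fst (f x)) ` E = fst ` edges ?G"
    unfolding bij_betw_imp_surj_on[OF f, symmetric] by (simp add: image_image)
  finally show ?thesis using D_graph_fst_image[OF s] by simp
qed

lemma parallel_class_eq_iff:
  assumes "A \<in> parallel_class ` E" "x \<in> E"
  shows "parallel_class x = A \<longleftrightarrow> x \<in> A"
  using assms self_in_parallel_class parallel_class_eq by blast

text \<open>In rank 2 the parallel classes determine the matroid. The right-hand side has the shape
  of \<open>graphic_indep_D_graph\<close>, with classes in place of \<open>fst\<close>.\<close>

lemma indep_iff_mrank_2:
  assumes "mrank = 2" "X \<subseteq> E"
  shows "indep X \<longleftrightarrow> inj_on parallel_class X \<and> card X \<le> 2"
proof
  assume "indep X"
  then show "inj_on parallel_class X \<and> card X \<le> 2"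
    using inj_on_parallel_class[of X] card_le_mrank[of X] assms by simp
next
  assume X: "inj_on parallel_class X \<and> card X \<le> 2"
  have fin: "finite X" using assms finite_ground finite_subset by blast
  consider "X = {}" | x where "X = {x}" | x y where "X = {x, y}" "x \<noteq> y"
  proof -
    have "card X = 0 \<or> card X = 1 \<or> card X = 2" using X by linarith
    then show thesis
      using that fin by (auto simp: card_2_iff card_1_singleton_iff)
  qed
  then show "indep X"
  proof cases
    case 1
    then show ?thesis using indep_empty by simp
  next
    case 2
    then show ?thesis using loopless assms by simp
  next
    case 3
    then have "y \<notin> parallel_class x"
      using X assms parallel_class_eq[of x y] by (auto simp: inj_on_def)
    then show ?thesis using 3 assms by (auto simp: parallel_class_def)
  qed
qed

text \<open>The edge multiplicities are the sizes of the three classes; the isomorphism labels the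
  class and enumerates its elements.\<close>

lemma iso_D_graph_exists:
  assumes r: "mrank = 2" and k: "card (parallel_class ` E) = 3"
  shows "\<exists>s\<^sub>1 s\<^sub>2 s\<^sub>3. s\<^sub>1 > 0 \<and> s\<^sub>2 > 0 \<and> s\<^sub>3 > 0 \<and>
    matroid_iso E indep (edges (D_graph s\<^sub>1 s\<^sub>2 s\<^sub>3)) (graphic_indep (D_graph s\<^sub>1 s\<^sub>2 s\<^sub>3))"
proof -
  obtain A B C where ABC: "parallel_class ` E = {A, B, C}" "A \<noteq> B" "B \<noteq> C" "A \<noteq> C"
    using k by (auto simp: card_3_iff)
  have pos: "0 < card Z" and fin: "finite Z" and sub: "Z \<subseteq> E" if Z: "Z \<in> {A, B, C}" for Z
  proof -
    obtain z where "z \<in> E" "Z = parallel_class z" using Z ABC(1) by (metis imageE)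
    then show "Z \<subseteq> E" using parallel_class_subset by simp
    then show "finite Z" using finite_ground finite_subset by blast
    then show "0 < card Z"
      using self_in_parallel_class[of z] \<open>z \<in> E\<close> \<open>Z = parallel_class z\<close> by (auto simp: card_gt_0_iff)
  qed
  have mem: "A \<in> parallel_class ` E" "B \<in> parallel_class ` E" "C \<in> parallel_class ` E"
    unfolding ABC(1) by simp_all
  note disjoint = mem[THEN parallel_class_disjoint]
  have disj: "A \<inter> B = {}" "B \<inter> C = {}" "A \<inter> C = {}"
    using disjoint(1)[of B] disjoint(2)[of C] disjoint(1)[of C] ABC by auto
  have cover: "E = A \<union> B \<union> C"
  proof
    show "E \<subseteq> A \<union> B \<union> C"
    proof
      fix x assume x: "x \<in> E"
      then have "parallel_class x \<in> {A, B, C}" using ABC(1) by blast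
      then show "x \<in> A \<union> B \<union> C" using self_in_parallel_class[OF x] by auto
    qed
  qed (use sub in auto)
  have "\<exists>h. bij_betw h Z {..<card Z}" if "Z \<in> {A, B, C}" for Z
    using ex_bij_betw_finite_nat[OF fin[OF that]] by (simp add: atLeast0LessThan)
  from this[of A] this[of B] this[of C]
  obtain h\<^sub>A h\<^sub>B h\<^sub>C where h: "bij_betw h\<^sub>A A {..<card A}" "bij_betw h\<^sub>B B {..<card B}"
      "bij_betw h\<^sub>C C {..<card C}"
    by auto
  let ?G = "D_graph (card A) (card B) (card C)"
  \<comment> \<open>On \<open>E\<close> the last branch means \<open>C\<close>, since the three
    classes cover \<open>E\<close>.\<close>
  define f :: "'a \<Rightarrow> nat \<times> nat" where
    "f x = (if x \<in> A then (1, h\<^sub>A x) else if x \<in> B then (2, h\<^sub>B x) else (3, h\<^sub>C x))" for x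
  have "bij_betw f A ({1} \<times> {..<card A})" "bij_betw f B ({2} \<times> {..<card B})"
      "bij_betw f C ({3} \<times> {..<card C})"
    using disj by (auto simp: f_def intro!: h[THEN bij_betw_tag])
  then have "bij_betw f (A \<union> B \<union> C)
      ({1} \<times> {..<card A} \<union> {2} \<times> {..<card B} \<union> {3} \<times> {..<card C})"
    by (intro bij_betw_combine) auto
  then have f: "bij_betw f E (edges ?G)" by (simp add: cover D_graph_def)
  have f_class: "fst (f x) = (if parallel_class x = A then 1 else if parallel_class x = B then 2 else 3)"
    if "x \<in> E" for x
    using parallel_class_eq_iff[OF mem(1) that] parallel_class_eq_iff[OF mem(2) that]
    by (simp add: f_def)
  have fst_f: "fst (f x) = fst (f y) \<longleftrightarrow> parallel_class x = parallel_class y"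
    if "x \<in> E" "y \<in> E" for x y
  proof -
    have "parallel_class x \<in> {A, B, C}" "parallel_class y \<in> {A, B, C}" using ABC(1) that by blast+
    then show ?thesis
      unfolding f_class[OF that(1)] f_class[OF that(2)] using ABC(2-4) by auto
  qed
  have "indep X \<longleftrightarrow> graphic_indep ?G (f ` X)" if X: "X \<subseteq> E" for X
  proof -
    have inj: "inj_on f X" using f X by (metis bij_betw_def inj_on_subset)
    have "inj_on fst (f ` X) \<longleftrightarrow> inj_on (fst \<circ> f) X" by (rule comp_inj_on_iff[OF inj])
    also have "\<dots> \<longleftrightarrow> inj_on parallel_class X"
      unfolding inj_on_def o_def using fst_f subsetD[OF X] by (intro ball_cong refl) simp
    finally have "inj_on fst (f ` X) \<longleftrightarrow> inj_on parallel_class X" .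
    moreover have "f ` X \<subseteq> edges ?G" using f X by (auto simp: bij_betw_def)
    ultimately show ?thesis
      by (simp add: graphic_indep_D_graph indep_iff_mrank_2[OF r X] card_image[OF inj])
  qed
  with f have "matroid_iso E indep (edges ?G) (graphic_indep ?G)"
    unfolding matroid_iso_def by (intro exI[of _ f]) simp
  then show ?thesis using pos[of A] pos[of B] pos[of C] by auto
qed

lemma uniform_1_iff: "0 < mrank \<Longrightarrow> is_uniform_matroid 1 (card E) E indep \<longleftrightarrow> mrank = 1"
proof
  assume U: "is_uniform_matroid 1 (card E) E indep" and r: "0 < mrank"
  obtain B where "indep B" "card B = mrank" using basis_exists by blast
  with U r show "mrank = 1" by (auto simp: is_uniform_matroid_def)
next
  assume r: "mrank = 1"
  obtain B where B: "indep B" "card B = mrank" using basis_exists by blast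
  \<comment> \<open>This is the clause \<open>r \<le> n\<close> of
    \<open>is_uniform_matroid\<close>.\<close>
  then have "1 \<le> card E"
    using card_mono[OF finite_ground indep_ground[OF B(1)]] r by simp
  moreover have "indep X" if "X \<subseteq> E" "card X \<le> 1" for X
  proof -
    have "card X = 0 \<or> card X = 1" using that by linarith
    then show ?thesis
      using that finite_subset[OF that(1) finite_ground] indep_empty loopless
      by (auto simp: card_1_singleton_iff)
  qed
  moreover have "X \<subseteq> E \<and> card X \<le> 1" if "indep X" for X
    using indep_ground[OF that] card_le_mrank[OF that] r by simp
  ultimately have "indep X \<longleftrightarrow> X \<subseteq> E \<and> card X \<le> 1" for X by blast
  with \<open>1 \<le> card E\<close> show "is_uniform_matroid 1 (card E) E indep"
    using finite_ground by (simp add: is_uniform_matroid_def)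
qed

end

text \<open>A facet of a point would have affine dimension -1 and be empty, which
  \<open>facet_of\<close> excludes; the value is 0 - (0 + 1).\<close>

lemma polytope_rank_indep_empty_only:
  fixes indep :: "'a::finite set \<Rightarrow> bool"
  assumes "\<And>I. indep I \<longleftrightarrow> I = {}"
  shows "polytope_rank (indep_polytope indep) = -1"
proof -
  have P: "indep_polytope indep = {0}" using assms by (simp add: indep_polytope_def)
  have "\<not> F facet_of {0 :: real ^ 'a}" for F
    using aff_dim_empty[of F] by (auto simp: facet_of_def)
  then show ?thesis by (simp add: P polytope_rank_def)
qed

section \<open>Conclusion by cases on the rank of the matroid\<close>

theorem theorem3p2:
  fixes E :: "'a::finite set" and indep :: "'a set \<Rightarrow> bool"
  assumes "matroid E indep"
    and "connected_matroid E indep"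
  shows "(polytope_rank (indep_polytope indep) = 0 \<longleftrightarrow>
      is_uniform_matroid 1 (card E) E indep) \<and>
    polytope_rank (indep_polytope indep) \<notin> {1, 2} \<and>
    (polytope_rank (indep_polytope indep) = 3 \<longleftrightarrow>
      (\<exists>s\<^sub>1 s\<^sub>2 s\<^sub>3. s\<^sub>1 > 0 \<and> s\<^sub>2 > 0 \<and> s\<^sub>3 > 0 \<and>
        matroid_iso E indep (edges (D_graph s\<^sub>1 s\<^sub>2 s\<^sub>3)) (graphic_indep (D_graph s\<^sub>1 s\<^sub>2 s\<^sub>3))))"
proof -
  interpret matroid E indep by (rule assms(1))
  let ?R = "polytope_rank (indep_polytope indep)"
  let ?iso = "\<lambda>s\<^sub>1 s\<^sub>2 s\<^sub>3.
    matroid_iso E indep (edges (D_graph s\<^sub>1 s\<^sub>2 s\<^sub>3)) (graphic_indep (D_graph s\<^sub>1 s\<^sub>2 s\<^sub>3))"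
  have iso_mrank: "2 \<le> mrank" if "s\<^sub>1 > 0" "s\<^sub>2 > 0" "s\<^sub>3 > 0" "?iso s\<^sub>1 s\<^sub>2 s\<^sub>3" for s\<^sub>1 s\<^sub>2 s\<^sub>3
    using iso_D_graph_mrank that by blast
  consider "mrank = 0" | "mrank = 1" | "2 \<le> mrank" by linarith
  then show ?thesis
  proof cases
    case 1
    have empty: "indep I \<longleftrightarrow> I = {}" for I
      using card_le_mrank[of I] finite_indep[of I] indep_empty 1 by auto
    have "\<not> is_uniform_matroid 1 (card E) E indep"
    proof
      assume U: "is_uniform_matroid 1 (card E) E indep"
      \<comment> \<open>The clause \<open>r \<le> n\<close> makes \<open>E\<close> nonempty.\<close>
      then obtain x where "x \<in> E" by (fastforce simp: is_uniform_matroid_def)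
      with U have "indep {x}" by (simp add: is_uniform_matroid_def)
      with empty show False by simp
    qed
    with polytope_rank_indep_empty_only[OF empty] iso_mrank 1 show ?thesis by fastforce
  next
    case 2
    interpret loopless_matroid E indep using connected_loopless assms(2) 2 by simp
    interpret independence_polytope E indep by unfold_locales (use 2 in simp)
    show ?thesis using polytope_rank_mrank_1[OF assms(2) 2] uniform_1_iff 2 iso_mrank by fastforce
  next
    case 3
    interpret loopless_matroid E indep using connected_loopless assms(2) 3 by simp
    interpret independence_polytope E indep by unfold_locales (use 3 in simp)
    let ?k = "card (parallel_class ` E)"
    have k: "mrank < ?k" using mrank_less_card_parallel_classes[OF assms(2) 3] .
    have R: "int ?k \<le> ?R" using polytope_rank_ge[OF assms(2) 3] .
    \<comment> \<open>In rank 2 the two numbers agree; in higher rank both are at least 4.\<close>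
    have "?R = 3 \<longleftrightarrow> ?k = 3"
      using R k 3 polytope_rank_mrank_2[OF assms(2)] by (cases "mrank = 2") auto
    also have "\<dots> \<longleftrightarrow> (\<exists>s\<^sub>1 s\<^sub>2 s\<^sub>3. s\<^sub>1 > 0 \<and> s\<^sub>2 > 0 \<and> s\<^sub>3 > 0 \<and> ?iso s\<^sub>1 s\<^sub>2 s\<^sub>3)"
      \<comment> \<open>With \<open>?k = 3\<close>, the bounds \<open>2 \<le> mrank\<close> and
        \<open>mrank < ?k\<close> force rank 2.\<close>
      using iso_D_graph_exists iso_D_graph_card_parallel_classes k 3
      by (metis less_Suc_eq_le le_antisym eval_nat_numeral(3))
    finally show ?thesis using R k 3 uniform_1_iff by auto
  qed
qed

end
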